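(* Let $\preceq$ be a partial order on a finite index set $\mathcal{I}$ with $n$ elements, let $G=(V,E)$ be a directed graph corresponding to $\preceq$, with $m$ edges, and let $D\in\mathbb{R}^{m\times n}$ be its oriented incidence matrix. For every vector $\bm{y}\in\mathbb{R}^n$ indexed by $\mathcal{I}$ and all penalisation parameters $\lambda_F,\lambda_L,\lambda_{NI}\ge0$, the following relations hold: $$\hat{\bm{\beta}}^{NI}(\bm{y},\lambda_{NI})=\hat{\bm{\beta}}^{F}\Big(\bm{y}-\tfrac{\lambda_{NI}}{2}D^{T}\bm{1},\ \tfrac12\lambda_{NI}\Big),$$ $$\hat{\bm{\beta}}^{FNI}(\bm{y},\lambda_F,\lambda_{NI})=\hat{\bm{\beta}}^{NI}\big(\bm{y}+\lambda_F D^{T}\bm{1},\ \lambda_{NI}+2\lambda_F\big)=\hat{\bm{\beta}}^{F}\Big(\bm{y}-\tfrac{\lambda_{NI}}{2}D^{T}\bm{1},\ \tfrac12\lambda_{NI}+\lambda_F\Big),$$ and $$\hat{\bm{\beta}}^{FLNI}(\bm{y},\lambda_F,\lambda_L,\lambda_{NI})=\hat{\bm{\beta}}^{FL}\Big(\bm{y}-\tfrac{\lambda_{NI}}{2}D^{T}\bm{1},\ \tfrac12\lambda_{NI}+\lambda_F,\ \lambda_L\Big).$$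
   Context: A vector $\bm{\beta}\in\mathbb{R}^n$ indexed by $\mathcal{I}$ is isotonic with respect to $\preceq$ if $\bm{j}_1\preceq\bm{j}_2$ implies $\beta_{\bm{j}_1}\le\beta_{\bm{j}_2}$. A directed graph $G=(V,E)$ corresponds to $\preceq$ if $V=\mathcal{I}$, $E$ is a set of ordered pairs of distinct elements of $\mathcal{I}$, and a vector $\bm{\beta}\in\mathbb{R}^n$ is isotonic with respect to $\preceq$ if and only if $\beta_{\bm{j}_1}\le\beta_{\bm{j}_2}$ for every $(\bm{j}_1,\bm{j}_2)\in E$. Label the vertices by $1,\dots,n$ and the edges by $1,\dots,m$. The oriented incidence matrix $D$ is the $m\times n$ matrix with $D_{i,j}=1$ if vertex $j$ is the source of edge $i$, $D_{i,j}=-1$ if vertex $j$ is the target of edge $i$, and $D_{i,j}=0$ otherwise (an edge $(\bm{i},\bm{j})$ has source $\bm{i}$ and target $\bm{j}$). $\bm{1}\in\mathbb{R}^m$ is the all-ones vector. Notation: $x_+=x\cdot 1\{x>0\}$; $\|\bm{z}\|_+=\sum_i(z_i)_+$; $\|\bm{z}\|_1=\sum_i|z_i|$. For $\bm{y}\in\mathbb{R}^n$ and nonnegative parameters, the estimators are the (unique) minimizers over $\bm{\beta}\in\mathbb{R}^n$: - nearly-isotonic regression: $\hat{\bm{\beta}}^{NI}(\bm{y},\lambda_{NI})=\arg\min_{\bm{\beta}}\tfrac12\|\bm{y}-\bm{\beta}\|_2^2+\lambda_{NI}\|D\bm{\beta}\|_+$; - fusion approximator: $\hat{\bm{\beta}}^{F}(\bm{y},\lambda_F)=\arg\min_{\bm{\beta}}\tfrac12\|\bm{y}-\bm{\beta}\|_2^2+\lambda_F\|D\bm{\beta}\|_1$;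 - fused lasso: $\hat{\bm{\beta}}^{FL}(\bm{y},\lambda_F,\lambda_L)=\arg\min_{\bm{\beta}}\tfrac12\|\bm{y}-\bm{\beta}\|_2^2+\lambda_F\|D\bm{\beta}\|_1+\lambda_L\|\bm{\beta}\|_1$; - fused lasso nearly-isotonic approximator: $\hat{\bm{\beta}}^{FLNI}(\bm{y},\lambda_F,\lambda_L,\lambda_{NI})=\arg\min_{\bm{\beta}}\tfrac12\|\bm{y}-\bm{\beta}\|_2^2+\lambda_F\|D\bm{\beta}\|_1+\lambda_L\|\bm{\beta}\|_1+\lambda_{NI}\|D\bm{\beta}\|_+$; - fused nearly-isotonic regression: $\hat{\bm{\beta}}^{FNI}(\bm{y},\lambda_F,\lambda_{NI})=\hat{\bm{\beta}}^{FLNI}(\bm{y},\lambda_F,0,\lambda_{NI})$. *)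

theory Defs
  imports
    "HOL-Analysis.Function_Topology"
    "Jordan_Normal_Form.Matrix"
    "Graph_Theory.Pair_Digraph"
begin

text \<open>
  A vector indexed by the finite set \<open>I\<close> is a function \<open>'a \<Rightarrow> real\<close>; its values outside \<open>I\<close> are
  irrelevant because a partial order on \<open>I\<close> satisfies \<open>r \<subseteq> I \<times> I\<close>.
\<close>

definition isotonic :: "'a rel \<Rightarrow> ('a \<Rightarrow> real) \<Rightarrow> bool" where
  "isotonic r \<beta> \<longleftrightarrow> (\<forall>j1 j2. (j1, j2) \<in> r \<longrightarrow> \<beta> j1 \<le> \<beta> j2)"

text \<open>
  The locale \<open>pair_loopfree_digraph\<close> says that the arcs are ordered pairs of distinct vertices.
\<close>

definition corresponds_to :: "'a pair_pre_digraph \<Rightarrow> 'a set \<Rightarrow> 'a rel \<Rightarrow> bool" where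
  "corresponds_to G I r \<longleftrightarrow>
     pair_loopfree_digraph G \<and> pverts G = I \<and>
     (\<forall>\<beta>. isotonic r \<beta> \<longleftrightarrow> (\<forall>j1 j2. (j1, j2) \<in> parcs G \<longrightarrow> \<beta> j1 \<le> \<beta> j2))"

text \<open>
  Labels start at 0, as matrix indices do: \<open>v j\<close> is the vertex with label \<open>j < n\<close> and \<open>e i\<close> the
  edge with label \<open>i < m\<close>, an edge being the pair of its source and its target.
\<close>

definition incidence_mat :: "nat \<Rightarrow> nat \<Rightarrow> (nat \<Rightarrow> 'a) \<Rightarrow> (nat \<Rightarrow> 'a \<times> 'a) \<Rightarrow> real mat" where
  "incidence_mat m n v e =
     mat m n (\<lambda>(i, j). if v j = fst (e i) then 1 else if v j = snd (e i) then -1 else 0)"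

definition sq_norm2 :: "real vec \<Rightarrow> real" where
  "sq_norm2 z = (\<Sum>i<dim_vec z. (z $ i)\<^sup>2)"

definition norm1 :: "real vec \<Rightarrow> real" where
  "norm1 z = (\<Sum>i<dim_vec z. \<bar>z $ i\<bar>)"

definition norm_plus :: "real vec \<Rightarrow> real" where
  "norm_plus z = (\<Sum>i<dim_vec z. z $ i * of_bool (z $ i > 0))"

definition NI_objective :: "real mat \<Rightarrow> real vec \<Rightarrow> real \<Rightarrow> real vec \<Rightarrow> real" where
  "NI_objective D y l_NI \<beta> = 1/2 * sq_norm2 (y - \<beta>) + l_NI * norm_plus (D *\<^sub>v \<beta>)"

definition F_objective :: "real mat \<Rightarrow> real vec \<Rightarrow> real \<Rightarrow> real vec \<Rightarrow> real" where
  "F_objective D y l_F \<beta> = 1/2 * sq_norm2 (y - \<beta>) + l_F * norm1 (D *\<^sub>v \<beta>)"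

definition FL_objective :: "real mat \<Rightarrow> real vec \<Rightarrow> real \<Rightarrow> real \<Rightarrow> real vec \<Rightarrow> real" where
  "FL_objective D y l_F l_L \<beta> =
     1/2 * sq_norm2 (y - \<beta>) + l_F * norm1 (D *\<^sub>v \<beta>) + l_L * norm1 \<beta>"

definition FLNI_objective ::
    "real mat \<Rightarrow> real vec \<Rightarrow> real \<Rightarrow> real \<Rightarrow> real \<Rightarrow> real vec \<Rightarrow> real" where
  "FLNI_objective D y l_F l_L l_NI \<beta> =
     1/2 * sq_norm2 (y - \<beta>) + l_F * norm1 (D *\<^sub>v \<beta>) + l_L * norm1 \<beta>
       + l_NI * norm_plus (D *\<^sub>v \<beta>)"

text \<open>
  \<open>arg_min_on\<close> selects some minimizer over the given set.  For nonnegative parameters and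
  \<open>y\<close> of the right dimension, the minimizers exist and are unique (\<open>NI_unique_minimizer\<close> etc.),
  so each estimator is the minimizer.
\<close>

definition NI_estimator :: "real mat \<Rightarrow> real vec \<Rightarrow> real \<Rightarrow> real vec" where
  "NI_estimator D y l_NI = arg_min_on (NI_objective D y l_NI) (carrier_vec (dim_col D))"

definition F_estimator :: "real mat \<Rightarrow> real vec \<Rightarrow> real \<Rightarrow> real vec" where
  "F_estimator D y l_F = arg_min_on (F_objective D y l_F) (carrier_vec (dim_col D))"

definition FL_estimator :: "real mat \<Rightarrow> real vec \<Rightarrow> real \<Rightarrow> real \<Rightarrow> real vec" where
  "FL_estimator D y l_F l_L = arg_min_on (FL_objective D y l_F l_L) (carrier_vec (dim_col D))"

definition FLNI_estimator :: "real mat \<Rightarrow> real vec \<Rightarrow> real \<Rightarrow> real \<Rightarrow> real \<Rightarrow> real vec" where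
  "FLNI_estimator D y l_F l_L l_NI =
     arg_min_on (FLNI_objective D y l_F l_L l_NI) (carrier_vec (dim_col D))"

definition FNI_estimator :: "real mat \<Rightarrow> real vec \<Rightarrow> real \<Rightarrow> real \<Rightarrow> real vec" where
  "FNI_estimator D y l_F l_NI = FLNI_estimator D y l_F 0 l_NI"

lemma box_compact:
  fixes R :: "nat \<Rightarrow> real"
  shows "compact {f :: nat \<Rightarrow> real. \<forall>i. \<bar>f i\<bar> \<le> R i}"
proof -
  have "compactin (product_topology (\<lambda>i. euclidean) UNIV) (PiE UNIV (\<lambda>i. {-R i..R i}))"
    by (subst compactin_PiE) (auto simp: compactin_euclidean_iff)
  then have "compact (PiE UNIV (\<lambda>i. {-R i..R i}))"
    by (simp add: euclidean_product_topology compactin_euclidean_iff)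
  moreover have "PiE UNIV (\<lambda>i. {-R i..R i}) = {f. \<forall>i. \<bar>f i\<bar> \<le> R i}"
    by (auto simp: PiE_def Pi_def abs_le_iff minus_le_iff)
  ultimately show ?thesis by simp
qed

lemma unique_minimizer:
  fixes g :: "real vec \<Rightarrow> real"
  assumes y: "y \<in> carrier_vec n"
    and cont: "continuous_on UNIV (\<lambda>f. g (vec n f))"
    and nonneg: "\<And>b. b \<in> carrier_vec n \<Longrightarrow> g b \<ge> 0"
    and mid: "\<And>a b. a \<in> carrier_vec n \<Longrightarrow> b \<in> carrier_vec n \<Longrightarrow>
                g ((1/2) \<cdot>\<^sub>v (a + b)) \<le> (g a + g b) / 2"
  shows "\<exists>!b. is_arg_min (\<lambda>b. 1/2 * sq_norm2 (y - b) + g b) (\<lambda>b. b \<in> carrier_vec n) b"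
proof -
  define F where "F = (\<lambda>b. 1/2 * sq_norm2 (y - b) + g b)"
  have Fvec: "F (vec n f) = 1/2 * (\<Sum>i<n. (y $ i - f i)\<^sup>2) + g (vec n f)" for f
    using y by (simp add: F_def sq_norm2_def)
  have contF: "continuous_on UNIV (\<lambda>f. F (vec n f))"
    unfolding Fvec by (intro continuous_intros cont continuous_on_product_coordinates)
  define c where "c = g y"
  have c0: "c \<ge> 0" using nonneg y by (simp add: c_def)
  define R where "R = (\<lambda>i. if i < n then \<bar>y $ i\<bar> + sqrt (2 * c) else 0)"
  define K where "K = {f :: nat \<Rightarrow> real. \<forall>i. \<bar>f i\<bar> \<le> R i}"
  have K0: "(\<lambda>i. if i < n then y $ i else 0) \<in> K"
    using c0 by (auto simp: K_def R_def)
  have "compact K" using box_compact[of R] by (simp add: K_def)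
  moreover have "K \<noteq> {}" using K0 by blast
  moreover have "continuous_on K (\<lambda>f. F (vec n f))" by (rule continuous_on_subset[OF contF]) simp
  ultimately have "\<exists>f\<in>K. \<forall>h\<in>K. F (vec n f) \<le> F (vec n h)" by (rule continuous_attains_inf)
  then obtain f where f: "f \<in> K" and fmin: "\<And>h. h \<in> K \<Longrightarrow> F (vec n f) \<le> F (vec n h)"
    by blast
  have vy: "vec n (\<lambda>i. if i < n then y $ i else 0) = y"
    using y by (intro eq_vecI) auto
  have Fy: "F y = c" using y by (simp add: F_def c_def sq_norm2_def)
  have fy: "F (vec n f) \<le> c" using fmin[OF K0] vy Fy by simp
  have glob: "F (vec n f) \<le> F b" if b: "b \<in> carrier_vec n" for b
  proof (cases "F b \<le> c")
    case False then show ?thesis using fy by linarith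
  next
    case True
    define h where "h = (\<lambda>i. if i < n then b $ i else 0)"
    have vh: "vec n h = b" using b by (intro eq_vecI) (auto simp: h_def)
    have "\<bar>b $ i\<bar> \<le> \<bar>y $ i\<bar> + sqrt (2 * c)" if i: "i < n" for i
    proof -
      have "(y $ i - b $ i)\<^sup>2 \<le> (\<Sum>i<n. (y $ i - b $ i)\<^sup>2)"
        by (rule member_le_sum) (use i in auto)
      also have "\<dots> = 2 * (F b - g b)"
        using b by (simp add: F_def sq_norm2_def)
      also have "\<dots> \<le> 2 * c" using True nonneg[OF b] by simp
      finally have "\<bar>y $ i - b $ i\<bar> \<le> sqrt (2 * c)"
        using real_le_rsqrt by (metis power2_abs)
      then show ?thesis by linarith
    qed
    then have "h \<in> K" by (auto simp: K_def R_def h_def)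
    from fmin[OF this] vh show ?thesis by simp
  qed
  have ex: "is_arg_min F (\<lambda>b. b \<in> carrier_vec n) (vec n f)"
    using glob by (auto simp: is_arg_min_def not_less)
  have uniq: "a = b" if "is_arg_min F (\<lambda>b. b \<in> carrier_vec n) a"
    "is_arg_min F (\<lambda>b. b \<in> carrier_vec n) b" for a b
  proof -
    from that have a: "a \<in> carrier_vec n" and b: "b \<in> carrier_vec n" and "F a = F b"
      and minF: "\<And>z. z \<in> carrier_vec n \<Longrightarrow> F a \<le> F z"
      by (auto simp: is_arg_min_def not_less intro!: antisym)
    define z where "z = (1/2 :: real) \<cdot>\<^sub>v (a + b)"
    have z: "z \<in> carrier_vec n" using a b by (simp add: z_def)
    have par: "sq_norm2 (y - z) = (sq_norm2 (y - a) + sq_norm2 (y - b)) / 2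
        - sq_norm2 (a - b) / 4"
    proof -
      have "sq_norm2 (y - z) =
          (\<Sum>i<n. ((y $ i - a $ i)\<^sup>2 + (y $ i - b $ i)\<^sup>2) / 2 - (a $ i - b $ i)\<^sup>2 / 4)"
        using a b y unfolding sq_norm2_def z_def
        by (intro sum.cong) (auto simp: power2_eq_square field_simps)
      then show ?thesis using a b y
        by (simp add: sq_norm2_def sum_subtractf sum.distrib sum_divide_distrib[symmetric])
    qed
    have "F z \<le> (F a + F b) / 2 - sq_norm2 (a - b) / 8"
      using mid[OF a b] par unfolding F_def z_def[symmetric] by argo
    with minF[OF z] \<open>F a = F b\<close> have "sq_norm2 (a - b) \<le> 0" by simp
    then have "(\<Sum>i<n. (a $ i - b $ i)\<^sup>2) = 0"
      using a b sum_nonneg[of "{..<n}" "\<lambda>i. (a $ i - b $ i)\<^sup>2"] by (simp add: sq_norm2_def)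
    then have "\<forall>i<n. a $ i = b $ i" by (subst (asm) sum_nonneg_eq_0_iff) auto
    then show "a = b" using a b by (intro eq_vecI) auto
  qed
  show ?thesis using ex uniq unfolding F_def by blast
qed

lemma norm_plus_alt: "norm_plus z = (\<Sum>i<dim_vec z. max 0 (z $ i))"
  unfolding norm_plus_def by (intro sum.cong) auto

lemma norm1_nonneg: "norm1 z \<ge> 0"
  by (simp add: norm1_def sum_nonneg)

lemma norm_plus_nonneg: "norm_plus z \<ge> 0"
  by (simp add: norm_plus_alt sum_nonneg)

lemma norm1_mid:
  assumes "a \<in> carrier_vec n" "b \<in> carrier_vec n"
  shows "norm1 ((1/2) \<cdot>\<^sub>v (a + b)) \<le> (norm1 a + norm1 b) / 2"
proof -
  have "norm1 ((1/2) \<cdot>\<^sub>v (a + b)) \<le> (\<Sum>i<n. (\<bar>a $ i\<bar> + \<bar>b $ i\<bar>) / 2)"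
    using assms unfolding norm1_def by (auto intro!: sum_mono)
  then show ?thesis using assms
    by (simp add: norm1_def sum.distrib sum_divide_distrib[symmetric])
qed

lemma norm_plus_mid:
  assumes "a \<in> carrier_vec n" "b \<in> carrier_vec n"
  shows "norm_plus ((1/2) \<cdot>\<^sub>v (a + b)) \<le> (norm_plus a + norm_plus b) / 2"
proof -
  have "norm_plus ((1/2) \<cdot>\<^sub>v (a + b)) \<le> (\<Sum>i<n. (max 0 (a $ i) + max 0 (b $ i)) / 2)"
    using assms unfolding norm_plus_alt by (auto intro!: sum_mono simp: max_def)
  then show ?thesis using assms
    by (simp add: norm_plus_alt sum.distrib sum_divide_distrib[symmetric])
qed

lemma mult_mat_vec_mid:
  assumes "a \<in> carrier_vec (dim_col D)" "b \<in> carrier_vec (dim_col D)"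
  shows "(D :: real mat) *\<^sub>v ((1/2) \<cdot>\<^sub>v (a + b)) = (1/2) \<cdot>\<^sub>v (D *\<^sub>v a + D *\<^sub>v b)"
proof -
  have D: "D \<in> carrier_mat (dim_row D) (dim_col D)" by simp
  show ?thesis
    using mult_mat_vec[OF D, of "a + b" "1/2"] mult_add_distrib_mat_vec[OF D assms] assms by simp
qed

theorem FLNI_unique_minimizer:
  assumes y: "y \<in> carrier_vec (dim_col D)" and pos: "l_F \<ge> 0" "l_L \<ge> 0" "l_NI \<ge> 0"
  shows "\<exists>!\<beta>. is_arg_min (FLNI_objective D y l_F l_L l_NI) (\<lambda>\<beta>. \<beta> \<in> carrier_vec (dim_col D)) \<beta>"
proof -
  define n where "n = dim_col D"
  define g where
    "g = (\<lambda>b. l_F * norm1 (D *\<^sub>v b) + l_L * norm1 b + l_NI * norm_plus (D *\<^sub>v b))"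
  have Dv: "(D *\<^sub>v vec n f) $ i = (\<Sum>j<n. D $$ (i, j) * f j)" if "i < dim_row D" for i f
    using that by (simp add: n_def scalar_prod_def atLeast0LessThan)
  have gv: "g (vec n f) = l_F * (\<Sum>i<dim_row D. \<bar>\<Sum>j<n. D $$ (i, j) * f j\<bar>)
      + l_L * (\<Sum>i<n. \<bar>f i\<bar>) + l_NI * (\<Sum>i<dim_row D. max 0 (\<Sum>j<n. D $$ (i, j) * f j))" for f
    unfolding g_def norm1_def norm_plus_alt by (simp add: Dv del: index_mult_mat_vec)
  have "\<exists>!b. is_arg_min (\<lambda>b. 1/2 * sq_norm2 (y - b) + g b) (\<lambda>b. b \<in> carrier_vec n) b"
  proof (rule unique_minimizer)
    show "y \<in> carrier_vec n" using y by (simp add: n_def)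
    show "continuous_on UNIV (\<lambda>f. g (vec n f))"
      unfolding gv by (intro continuous_intros continuous_on_product_coordinates)
    show "g b \<ge> 0" for b
      using pos by (simp add: g_def norm1_nonneg norm_plus_nonneg)
    show "g ((1/2) \<cdot>\<^sub>v (a + b)) \<le> (g a + g b) / 2"
      if a: "a \<in> carrier_vec n" and b: "b \<in> carrier_vec n" for a b
    proof -
      have Da: "D *\<^sub>v a \<in> carrier_vec (dim_row D)" and Db: "D *\<^sub>v b \<in> carrier_vec (dim_row D)"
        by (auto intro: carrier_vecI)
      have "g ((1/2) \<cdot>\<^sub>v (a + b)) \<le> l_F * ((norm1 (D *\<^sub>v a) + norm1 (D *\<^sub>v b)) / 2)
          + l_L * ((norm1 a + norm1 b) / 2)
          + l_NI * ((norm_plus (D *\<^sub>v a) + norm_plus (D *\<^sub>v b)) / 2)"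
        unfolding g_def mult_mat_vec_mid[OF a[unfolded n_def] b[unfolded n_def]]
        by (intro add_mono mult_left_mono norm1_mid[OF Da Db] norm1_mid[OF a b]
            norm_plus_mid[OF Da Db] pos)
      also have "\<dots> = (g a + g b) / 2" by (simp add: g_def field_simps)
      finally show ?thesis .
    qed
  qed
  then show ?thesis
    unfolding g_def n_def FLNI_objective_def by (simp add: add.assoc)
qed

corollary NI_unique_minimizer:
  assumes "y \<in> carrier_vec (dim_col D)" "l_NI \<ge> 0"
  shows "\<exists>!\<beta>. is_arg_min (NI_objective D y l_NI) (\<lambda>\<beta>. \<beta> \<in> carrier_vec (dim_col D)) \<beta>"
proof -
  have "NI_objective D y l_NI = FLNI_objective D y 0 0 l_NI"
    by (intro ext) (simp add: NI_objective_def FLNI_objective_def)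
  then show ?thesis using FLNI_unique_minimizer[OF assms(1), of 0 0 l_NI] assms(2) by simp
qed

corollary FL_unique_minimizer:
  assumes "y \<in> carrier_vec (dim_col D)" "l_F \<ge> 0" "l_L \<ge> 0"
  shows "\<exists>!\<beta>. is_arg_min (FL_objective D y l_F l_L) (\<lambda>\<beta>. \<beta> \<in> carrier_vec (dim_col D)) \<beta>"
proof -
  have "FL_objective D y l_F l_L = FLNI_objective D y l_F l_L 0"
    by (intro ext) (simp add: FL_objective_def FLNI_objective_def)
  then show ?thesis using FLNI_unique_minimizer[OF assms(1), of l_F l_L 0] assms(2,3) by simp
qed

corollary F_unique_minimizer:
  assumes "y \<in> carrier_vec (dim_col D)" "l_F \<ge> 0"
  shows "\<exists>!\<beta>. is_arg_min (F_objective D y l_F) (\<lambda>\<beta>. \<beta> \<in> carrier_vec (dim_col D)) \<beta>"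
proof -
  have "F_objective D y l_F = FL_objective D y l_F 0"
    by (intro ext) (simp add: F_objective_def FL_objective_def)
  then show ?thesis using FL_unique_minimizer[OF assms(1), of l_F 0] assms(2) by simp
qed

end

theory Submission
  imports Defs
begin

text \<open>
  Write \<open>w = D\<^sup>T 1\<close>. Since \<open>2 x\<^sub>+ = \<bar>x\<bar> + x\<close>, twice the nearly-isotonic penalty equals the fusion
  penalty plus the sum of the entries of \<open>D \<beta>\<close>, and that sum is the linear functional
  \<open>w \<bullet> \<beta>\<close>. Completing the square absorbs a linear functional of \<open>\<beta>\<close> into the data: replacing
  \<open>y\<close> by \<open>y + t w\<close> in the quadratic loss contributes \<open>- t (w \<bullet> \<beta>)\<close> and a term free of \<open>\<beta>\<close>.
  So an amount \<open>t\<close> of fusion penalty may be traded for an amount \<open>2 t\<close> of nearly-isotonic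
  penalty, at the price of shifting the data by \<open>t w\<close>: the two objectives differ by a
  constant (\<open>FLNI_objective_shift\<close>), hence have the same minimizers
  (\<open>FLNI_estimator_shift\<close>).

  The claimed relations are instances of this one exchange. Trading away the whole
  nearly-isotonic penalty (\<open>t = l_NI / 2\<close>) leaves the fused lasso, and trading away the whole
  fusion penalty (\<open>t = l_F\<close>) leaves nearly-isotonic regression.
\<close>

lemma two_norm_plus: "2 * norm_plus z = norm1 z + (\<Sum>i<dim_vec z. z $ i)"
  unfolding norm_plus_alt norm1_def sum_distrib_left sum.distrib[symmetric]
  by (intro sum.cong) auto

text \<open>
  The adjoint relation between \<open>D\<close> and its transpose, paired with the all-ones vector: this is
  how the linear part of the nearly-isotonic penalty becomes a shift of the data.
\<close>

lemma transpose_ones_scalar_prod: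
  fixes D :: "real mat"
  assumes "\<beta> \<in> carrier_vec (dim_col D)"
  shows "(D\<^sup>T *\<^sub>v vec (dim_row D) (\<lambda>_. 1)) \<bullet> \<beta> = (\<Sum>i<dim_row D. (D *\<^sub>v \<beta>) $ i)"
proof -
  have "(D\<^sup>T *\<^sub>v vec (dim_row D) (\<lambda>_. 1)) \<bullet> \<beta>
      = (\<Sum>j<dim_col D. \<Sum>i<dim_row D. D $$ (i, j) * \<beta> $ j)"
    using assms by (simp add: scalar_prod_def atLeast0LessThan sum_distrib_right)
  also have "\<dots> = (\<Sum>i<dim_row D. \<Sum>j<dim_col D. D $$ (i, j) * \<beta> $ j)"
    by (rule sum.swap)
  also have "\<dots> = (\<Sum>i<dim_row D. (D *\<^sub>v \<beta>) $ i)"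
    using assms by (simp add: scalar_prod_def atLeast0LessThan)
  finally show ?thesis .
qed

lemma sq_norm2_shift:
  assumes "y \<in> carrier_vec n" "w \<in> carrier_vec n" "\<beta> \<in> carrier_vec n"
  shows "sq_norm2 (y + t \<cdot>\<^sub>v w - \<beta>)
    = sq_norm2 (y - \<beta>) - 2 * t * (w \<bullet> \<beta>) + (2 * t * (w \<bullet> y) + t\<^sup>2 * sq_norm2 w)"
proof -
  have "sq_norm2 (y + t \<cdot>\<^sub>v w - \<beta>)
      = (\<Sum>i<n. (y $ i - \<beta> $ i)\<^sup>2 - 2 * t * (w $ i * \<beta> $ i)
          + (2 * t * (w $ i * y $ i) + t\<^sup>2 * (w $ i)\<^sup>2))"
    using assms unfolding sq_norm2_def
    by (intro sum.cong) (auto simp: power2_eq_square algebra_simps)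
  then show ?thesis using assms
    by (simp add: sq_norm2_def scalar_prod_def atLeast0LessThan sum.distrib sum_subtractf
        sum_distrib_left)
qed

text \<open>
  The linear term \<open>- t (w \<bullet> \<beta>)\<close> of the shifted loss cancels the linear part of the additional
  nearly-isotonic penalty \<open>2 t\<close>, and the part that remains of it is the fusion penalty \<open>t\<close>.
\<close>

lemma FLNI_objective_shift:
  fixes D :: "real mat"
  defines "w \<equiv> D\<^sup>T *\<^sub>v vec (dim_row D) (\<lambda>_. 1)"
  assumes y: "y \<in> carrier_vec (dim_col D)" and \<beta>: "\<beta> \<in> carrier_vec (dim_col D)"
  shows "FLNI_objective D (y + t \<cdot>\<^sub>v w) l_F l_L (l_NI + 2 * t) \<beta>
    = FLNI_objective D y (l_F + t) l_L l_NI \<beta> + (t * (w \<bullet> y) + t\<^sup>2 / 2 * sq_norm2 w)"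
proof -
  have w: "w \<in> carrier_vec (dim_col D)" by (auto simp: w_def intro: carrier_vecI)
  have trade: "2 * norm_plus (D *\<^sub>v \<beta>) = norm1 (D *\<^sub>v \<beta>) + w \<bullet> \<beta>"
    unfolding w_def transpose_ones_scalar_prod[OF \<beta>] two_norm_plus by simp
  have "l_NI * norm_plus (D *\<^sub>v \<beta>) + t * (norm1 (D *\<^sub>v \<beta>) + w \<bullet> \<beta>)
      = (l_NI + 2 * t) * norm_plus (D *\<^sub>v \<beta>)"
    unfolding trade[symmetric] by (simp add: algebra_simps)
  then show ?thesis
    unfolding FLNI_objective_def sq_norm2_shift[OF y w \<beta>] by (simp add: algebra_simps)
qed

text \<open>
  \<open>arg_min_on\<close> is a choice that depends only on the predicate of being a minimizer, so functions
  with the same minimizers on \<open>S\<close> get the same chosen one.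
\<close>

lemma arg_min_on_add_const:
  fixes f g :: "'b \<Rightarrow> real"
  assumes "\<And>x. x \<in> S \<Longrightarrow> f x = g x + c"
  shows "arg_min_on f S = arg_min_on g S"
proof -
  have "is_arg_min f (\<lambda>x. x \<in> S) = is_arg_min g (\<lambda>x. x \<in> S)"
    using assms by (auto simp: is_arg_min_def fun_eq_iff)
  then show ?thesis by (simp add: arg_min_on_def arg_min_def)
qed

lemma FLNI_estimator_shift:
  fixes D :: "real mat"
  assumes "y \<in> carrier_vec (dim_col D)"
  shows "FLNI_estimator D (y + t \<cdot>\<^sub>v (D\<^sup>T *\<^sub>v vec (dim_row D) (\<lambda>_. 1))) l_F l_L (l_NI + 2 * t)
    = FLNI_estimator D y (l_F + t) l_L l_NI"
  unfolding FLNI_estimator_def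
  by (rule arg_min_on_add_const) (rule FLNI_objective_shift[OF assms])

lemma NI_estimator_eq_FLNI: "NI_estimator D y l_NI = FLNI_estimator D y 0 0 l_NI"
  by (simp add: NI_estimator_def FLNI_estimator_def NI_objective_def[abs_def]
      FLNI_objective_def[abs_def])

lemma FL_estimator_eq_FLNI: "FL_estimator D y l_F l_L = FLNI_estimator D y l_F l_L 0"
  by (simp add: FL_estimator_def FLNI_estimator_def FL_objective_def[abs_def]
      FLNI_objective_def[abs_def])

lemma F_estimator_eq_FL: "F_estimator D y l_F = FL_estimator D y l_F 0"
  by (simp add: F_estimator_def FL_estimator_def F_objective_def[abs_def]
      FL_objective_def[abs_def])

theorem proposition1:
  fixes I :: "'a set" and r :: "'a rel" and G :: "'a pair_pre_digraph"
    and n m :: nat and v :: "nat \<Rightarrow> 'a" and e :: "nat \<Rightarrow> 'a \<times> 'a"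
    and D :: "real mat" and y :: "real vec" and l_F l_L l_NI :: real
  assumes "finite I" and "card I = n" and "partial_order_on I r"
    and "corresponds_to G I r" and "card (parcs G) = m"
    and "bij_betw v {..<n} I" and "bij_betw e {..<m} (parcs G)"
    and "D = incidence_mat m n v e"
    and "y \<in> carrier_vec n"
    and "l_F \<ge> 0" and "l_L \<ge> 0" and "l_NI \<ge> 0"
  shows "NI_estimator D y l_NI
           = F_estimator D (y - (l_NI / 2) \<cdot>\<^sub>v (D\<^sup>T *\<^sub>v vec m (\<lambda>_. 1))) (1/2 * l_NI)
       \<and> FNI_estimator D y l_F l_NI
           = NI_estimator D (y + l_F \<cdot>\<^sub>v (D\<^sup>T *\<^sub>v vec m (\<lambda>_. 1))) (l_NI + 2 * l_F)
       \<and> NI_estimator D (y + l_F \<cdot>\<^sub>v (D\<^sup>T *\<^sub>v vec m (\<lambda>_. 1))) (l_NI + 2 * l_F)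
           = F_estimator D (y - (l_NI / 2) \<cdot>\<^sub>v (D\<^sup>T *\<^sub>v vec m (\<lambda>_. 1))) (1/2 * l_NI + l_F)
       \<and> FLNI_estimator D y l_F l_L l_NI
           = FL_estimator D (y - (l_NI / 2) \<cdot>\<^sub>v (D\<^sup>T *\<^sub>v vec m (\<lambda>_. 1))) (1/2 * l_NI + l_F) l_L"
proof -
  define w where "w = D\<^sup>T *\<^sub>v vec m (\<lambda>_. 1)"
  have dims: "dim_row D = m" "dim_col D = n"
    using assms by (simp_all add: incidence_mat_def)
  have y: "y \<in> carrier_vec (dim_col D)" using assms dims by simp
  have w: "w \<in> carrier_vec (dim_col D)" by (auto simp: w_def intro: carrier_vecI)
  have shift: "FLNI_estimator D (z + t \<cdot>\<^sub>v w) a b (c + 2 * t) = FLNI_estimator D z (a + t) b c"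
    if "z \<in> carrier_vec (dim_col D)" for z a b c t
    using FLNI_estimator_shift[OF that] by (simp add: w_def dims)
  \<comment> \<open>Undoing the shift of \<open>y\<close> by \<open>- (l_NI / 2) w\<close> with \<open>t = l_NI / 2\<close> restores exactly the
    nearly-isotonic weight \<open>l_NI\<close>, starting from weight zero.\<close>
  have fusion: "FLNI_estimator D y a b l_NI
      = FL_estimator D (y - (l_NI / 2) \<cdot>\<^sub>v w) (1/2 * l_NI + a) b" for a b
  proof -
    have "y - (l_NI / 2) \<cdot>\<^sub>v w + (l_NI / 2) \<cdot>\<^sub>v w = y"
      using y w by (intro eq_vecI) auto
    moreover have "y - (l_NI / 2) \<cdot>\<^sub>v w \<in> carrier_vec (dim_col D)" using y w by simp
    ultimately show ?thesis
      using shift[of "y - (l_NI / 2) \<cdot>\<^sub>v w" "l_NI / 2" a b 0]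
      by (simp add: FL_estimator_eq_FLNI add.commute)
  qed
  have iso: "FNI_estimator D y l_F l_NI = NI_estimator D (y + l_F \<cdot>\<^sub>v w) (l_NI + 2 * l_F)"
    using shift[OF y, of l_F 0 0 l_NI] by (simp add: FNI_estimator_def NI_estimator_eq_FLNI)
  show ?thesis
    unfolding w_def[symmetric] iso[symmetric]
    using fusion[of 0 0] fusion[of l_F 0] fusion[of l_F l_L]
    by (simp add: NI_estimator_eq_FLNI F_estimator_eq_FL FNI_estimator_def)
qed

end
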